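(* Let $A=(a_{ij})$ be an indecomposable symmetric generalized $n\times n$ Cartan matrix, and let $c=\sigma_{v_n}\cdots\sigma_{v_1}$ be a Coxeter element of the Weyl group $\mathcal W$ of $A$. Then $\mathcal W$ is infinite if and only if for all $m\in\mathbb Z$, $\ell(c^m)=|m|n$.
   Context: An indecomposable symmetric generalized $n\times n$ Cartan matrix is a symmetric integral matrix $A=(a_{ij})$ with $a_{ii}=2$ for all $i$ and $a_{ij}\le 0$ for $i\ne j$ that is not conjugate under a permutation matrix to a block-diagonal matrix with two nontrivial diagonal blocks. Let $e_1,\dots,e_n$ be the standard basis of $\mathbb Z^n$ and let $\sigma_i$ (simple reflection) be the automorphism of $\mathbb Z^n$ with $\sigma_i(e_j)=e_j-a_{ij}e_i$ for all $i,j$. The Weyl group $\mathcal W$ is the subgroup of $GL(\mathbb Z^n)$ generated by $\sigma_1,\dots,\sigma_n$. A Coxeter element is a product $\sigma_{v_n}\cdots\sigma_{v_1}$ where $v_1,\dots,v_n$ is any permutation of $1,\dots,n$. The length $\ell(w)$ of $w\in\mathcal W$ is the least $l\ge0$ such that $w$ is a product of $l$ simple reflections. *)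

theory Defs
  imports
    "HOL-Analysis.Finite_Cartesian_Product"
    "HOL-Algebra.Bij"
    "HOL-Algebra.Generated_Groups"
begin

(* The index set 1, ..., n is a finite type 'n, so n = CARD('n) >= 1, and the lattice Z^n is
   int ^ 'n with standard basis vectors axis i 1. *)

definition symmetric_gcm :: "int ^ 'n ^ 'n \<Rightarrow> bool" where
  "symmetric_gcm A \<longleftrightarrow>
     transpose A = A \<and> (\<forall>i. A $ i $ i = 2) \<and> (\<forall>i j. i \<noteq> j \<longrightarrow> A $ i $ j \<le> 0)"

(* The type 'n carries no order, so conjugating by a permutation matrix amounts to choosing the
   enumeration e of the indices: the conjugate has the entry A $ e i $ e j in position (i, j) of
   {..<n} x {..<n}.  Its two diagonal blocks occupy the positions below k and from k on. *)
definition indecomposable :: "int ^ 'n ^ 'n \<Rightarrow> bool" where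
  "indecomposable A \<longleftrightarrow>
     \<not> (\<exists>(e :: nat \<Rightarrow> 'n) k. bij_betw e {..<CARD('n)} UNIV \<and> 0 < k \<and> k < CARD('n) \<and>
          (\<forall>i \<in> {..<k}. \<forall>j \<in> {k..<CARD('n)}. A $ e i $ e j = 0 \<and> A $ e j $ e i = 0))"

definition lattice_group :: "(int ^ 'n) monoid" where
  "lattice_group = \<lparr>carrier = UNIV, mult = (+), one = 0\<rparr>"

definition GL_lattice :: "(int ^ 'n \<Rightarrow> int ^ 'n) monoid" where
  "GL_lattice = AutoGroup lattice_group"

(* The linear extension of e_j |-> e_j - a_ij e_i; see simple_reflection_axis. *)
definition simple_reflection :: "int ^ 'n ^ 'n \<Rightarrow> 'n \<Rightarrow> int ^ 'n \<Rightarrow> int ^ 'n" where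
  "simple_reflection A i x = x - ((A *v x) $ i) *s axis i 1"

definition weyl_group :: "int ^ 'n ^ 'n \<Rightarrow> (int ^ 'n \<Rightarrow> int ^ 'n) set" where
  "weyl_group A = generate GL_lattice (range (simple_reflection A))"

definition reflection_product :: "int ^ 'n ^ 'n \<Rightarrow> 'n list \<Rightarrow> int ^ 'n \<Rightarrow> int ^ 'n" where
  "reflection_product A js =
     foldr (\<lambda>f g. f \<otimes>\<^bsub>GL_lattice\<^esub> g) (map (simple_reflection A) js) \<one>\<^bsub>GL_lattice\<^esub>"

(* For vs = [v_1, ..., v_n] this is sigma_{v_n} ... sigma_{v_1}. *)
definition coxeter_element :: "int ^ 'n ^ 'n \<Rightarrow> 'n list \<Rightarrow> int ^ 'n \<Rightarrow> int ^ 'n" where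
  "coxeter_element A vs = reflection_product A (rev vs)"

definition weyl_length :: "int ^ 'n ^ 'n \<Rightarrow> (int ^ 'n \<Rightarrow> int ^ 'n) \<Rightarrow> nat" where
  "weyl_length A w = (LEAST l. \<exists>js. length js = l \<and> reflection_product A js = w)"

lemma simple_reflection_axis:
  "simple_reflection A i (axis j 1) = axis j 1 - (A $ i $ j) *s axis i 1"
  by (simp add: simple_reflection_def matrix_vector_mult_def axis_def if_distrib cong: if_cong)

lemma group_lattice_group: "group (lattice_group :: (int ^ 'n) monoid)"
proof (rule groupI)
  fix x :: "int ^ 'n"
  show "\<exists>y\<in>carrier lattice_group. y \<otimes>\<^bsub>lattice_group\<^esub> x = \<one>\<^bsub>lattice_group\<^esub>"
    by (rule bexI [of _ "- x"]) (simp_all add: lattice_group_def)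
qed (simp_all add: lattice_group_def add.assoc)

lemma group_GL_lattice: "group GL_lattice"
  unfolding GL_lattice_def by (rule group.AutoGroup [OF group_lattice_group])

lemma carrier_GL_lattice:
  "f \<in> carrier GL_lattice \<longleftrightarrow> (\<forall>x y. f (x + y) = f x + f y) \<and> bij f"
  by (auto simp: GL_lattice_def AutoGroup_def auto_def hom_def Bij_def lattice_group_def
      extensional_def)

lemma mult_GL_lattice:
  assumes "f \<in> carrier GL_lattice" and "g \<in> carrier GL_lattice"
  shows "f \<otimes>\<^bsub>GL_lattice\<^esub> g = f \<circ> g"
proof -
  have "f \<in> Bij UNIV" "g \<in> Bij UNIV"
    using assms by (simp_all add: GL_lattice_def AutoGroup_def auto_def lattice_group_def)
  then show ?thesis
    by (simp add: GL_lattice_def AutoGroup_def BijGroup_def lattice_group_def compose_def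
        restrict_def fun_eq_iff)
qed

lemma one_GL_lattice: "\<one>\<^bsub>GL_lattice\<^esub> = id"
  by (auto simp: GL_lattice_def AutoGroup_def BijGroup_def lattice_group_def restrict_def)

lemma simple_reflection_involution:
  assumes "symmetric_gcm A"
  shows "simple_reflection A i (simple_reflection A i x) = x"
proof -
  have d: "A $ i $ i = 2"
    using assms by (simp add: symmetric_gcm_def)
  have "(A *v (x - c *s axis i 1)) $ i = (A *v x) $ i - 2 * c" for c
  proof -
    have "(A *v (x - c *s axis i 1)) $ i =
        (\<Sum>j\<in>UNIV. A $ i $ j * x $ j - (if j = i then 2 * c else 0))"
      by (auto simp: matrix_vector_mult_def axis_def right_diff_distrib d intro!: sum.cong)
    then show ?thesis
      by (simp add: sum_subtractf matrix_vector_mult_def)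
  qed
  then show ?thesis
    by (simp add: simple_reflection_def vec_eq_iff)
qed

lemma simple_reflection_in_GL:
  assumes "symmetric_gcm A"
  shows "simple_reflection A i \<in> carrier GL_lattice"
proof -
  have "bij (simple_reflection A i)"
    by (rule o_bij [where g = "simple_reflection A i"])
      (simp_all add: fun_eq_iff simple_reflection_involution [OF assms])
  moreover have "simple_reflection A i (x + y) =
      simple_reflection A i x + simple_reflection A i y" for x y
    by (simp add: simple_reflection_def vec_eq_iff matrix_vector_mult_def algebra_simps
        sum.distrib)
  ultimately show ?thesis
    by (simp add: carrier_GL_lattice)
qed

lemma weyl_group_eq_products:
  fixes A :: "int ^ 'n ^ 'n"
  assumes "symmetric_gcm A"
  shows "weyl_group A = range (reflection_product A)"
proof -
  interpret GL: group "GL_lattice :: (int ^ 'n \<Rightarrow> int ^ 'n) monoid"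
    by (rule group_GL_lattice)
  note s = simple_reflection_in_GL [OF assms]
  have nil: "reflection_product A [] = \<one>\<^bsub>GL_lattice\<^esub>"
    by (simp add: reflection_product_def)
  have cons: "reflection_product A (j # js) =
      simple_reflection A j \<otimes>\<^bsub>GL_lattice\<^esub> reflection_product A js" for j js
    by (simp add: reflection_product_def)
  have closed: "reflection_product A js \<in> carrier GL_lattice" for js
    by (induction js) (simp_all add: nil cons s)
  have app: "reflection_product A (js @ ks) =
      reflection_product A js \<otimes>\<^bsub>GL_lattice\<^esub> reflection_product A ks" for js ks
    by (induction js) (simp_all add: nil cons s closed GL.m_assoc)
  have single: "reflection_product A [j] = simple_reflection A j" for j
    by (simp add: nil cons s)
  have inv_s: "inv\<^bsub>GL_lattice\<^esub> simple_reflection A j = simple_reflection A j" for j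
  proof (rule GL.inv_equality)
    have "simple_reflection A j \<circ> simple_reflection A j = id"
      by (rule ext) (simp add: simple_reflection_involution [OF assms])
    then show "simple_reflection A j \<otimes>\<^bsub>GL_lattice\<^esub> simple_reflection A j =
        \<one>\<^bsub>GL_lattice\<^esub>"
      by (simp only: mult_GL_lattice [OF s s] one_GL_lattice)
  qed (rule s)+
  have "f \<in> range (reflection_product A)"
    if "f \<in> generate GL_lattice (range (simple_reflection A))" for f
    using that
  proof induction
    case one
    show ?case by (metis nil rangeI)
  next
    case (incl h)
    then show ?case by (metis single imageE rangeI)
  next
    case (inv h)
    then show ?case by (metis single inv_s imageE rangeI)
  next
    case (eng h1 h2)
    then obtain js ks where "h1 = reflection_product A js" "h2 = reflection_product A ks"
      by blast
    then have "h1 \<otimes>\<^bsub>GL_lattice\<^esub> h2 = reflection_product A (js @ ks)"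
      by (simp only: app)
    then show ?case by (rule range_eqI)
  qed
  moreover have "reflection_product A js \<in> generate GL_lattice (range (simple_reflection A))"
    for js
    by (induction js) (auto simp: nil cons intro: generate.intros)
  ultimately show ?thesis
    unfolding weyl_group_def by blast
qed

end

theory Submission
  imports Defs "HOL-Analysis.Cartesian_Euclidean_Space"
begin

text \<open>If every power of \<open>c\<close> has the stated length, then the powers are pairwise distinct and
\<open>\<W>\<close> is infinite. The work is in the converse. Put \<open>s\<^sub>1 \<dots> s\<^sub>n = c\<close> and repeat this word
periodically, so that \<open>s\<^sub>t\<close> makes sense for all \<open>t\<close>; let \<open>\<alpha>\<^sub>t\<close> be the basis vector
belonging to \<open>s\<^sub>t\<close> and \<open>\<beta>\<^sub>t = s\<^sub>1 \<dots> s\<^bsub>t-1\<^esub> \<alpha>\<^sub>t\<close>. A word is reduced once all its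
\<open>\<beta>\<^sub>t\<close> have nonnegative coordinates (\<open>reduced_if_roots_nonneg\<close>), and if
\<open>\<beta>\<^sub>t\<close> fails to be nonnegative, then \<open>\<beta>\<^sub>t = - \<beta>\<^sub>r\<close> for some \<open>r < t\<close>
(\<open>negative_root_source\<close>). Both facts rest on the theorem that each root has all coordinates
of one sign, with the sign decided by lengths (\<open>root_nonneg_if_not_shorter\<close>).

It therefore suffices to find a linear functional \<open>\<phi>\<close> that is positive on every \<open>\<beta>\<^sub>t\<close>.
If \<open>\<W>\<close> is infinite, the quadratic form of \<open>A\<close> is not positive definite, and by a
Perron-Frobenius argument there is a real vector \<open>x > 0\<close> with \<open>A x \<le> 0\<close>
(\<open>superharmonic_if_infinite\<close>). Split \<open>A = E + E\<^sup>T\<close> with \<open>E\<close> unitriangular for the order of the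
letters in the word, and let \<open>\<phi>\<close> be the pairing with \<open>x\<close> under the form \<open>E\<close>. Then
\<open>\<phi> (\<beta>\<^sub>t) = x\<^sub>t > 0\<close> during the first period, and
\<open>\<phi> (c z) = \<phi> (z) - (A x) \<cdot> z \<ge> \<phi> (z)\<close> whenever \<open>z \<ge> 0\<close>. Since \<open>\<beta>\<^bsub>t+n\<^esub> = c \<beta>\<^sub>t\<close>,
positivity of the roots and of \<open>\<phi>\<close> can be carried along the word by one induction
(\<open>periodic_roots_positive\<close>): the root is needed nonnegative for \<open>\<phi>\<close> to grow, and
\<open>\<phi>\<close> positive on \<open>\<beta>\<^sub>r\<close> and \<open>\<beta>\<^sub>t\<close> excludes \<open>\<beta>\<^sub>t = - \<beta>\<^sub>r\<close>. Negative powers follow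
because a word and its reverse have the same length.\<close>

section \<open>Reflections, words and the invariant form\<close>

definition nonneg_vec :: "int ^ 'n \<Rightarrow> bool" where
  "nonneg_vec x \<longleftrightarrow> (\<forall>i. 0 \<le> x $ i)"

lemma nonneg_axis: "nonneg_vec (axis i 1)"
  by (simp add: nonneg_vec_def axis_def)

lemma nonneg_combination:
  "nonneg_vec x \<Longrightarrow> nonneg_vec y \<Longrightarrow> 0 \<le> a \<Longrightarrow> 0 \<le> b \<Longrightarrow> nonneg_vec (a *s x + b *s y)"
  by (simp add: nonneg_vec_def)

definition cartan_norm :: "int ^ 'n ^ 'n \<Rightarrow> int ^ 'n \<Rightarrow> int" where
  "cartan_norm A x = (\<Sum>i\<in>UNIV. x $ i * (A *v x) $ i)"

text \<open>The words \<open>\<dots> s t s t\<close> with \<open>p\<close> letters. The last letter is the fixed one because words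
act on vectors from the right end.\<close>

fun alternating :: "'a \<Rightarrow> 'a \<Rightarrow> nat \<Rightarrow> 'a list" where
  "alternating s t 0 = []"
| "alternating s t (Suc p) = alternating t s p @ [t]"

lemma length_alternating [simp]: "length (alternating s t p) = p"
  by (induction p arbitrary: s t) auto

lemma alternating_Suc_left:
  "alternating s t (Suc p) = (if even p then t else s) # alternating s t p"
proof (induction p arbitrary: s t)
  case (Suc p)
  have "alternating s t (Suc (Suc p)) = alternating t s (Suc p) @ [t]"
    by simp
  also have "\<dots> = (if even p then s else t) # alternating t s p @ [t]"
    by (simp only: Suc append_Cons)
  finally show ?case
    by simp
qed simp

context
  fixes A :: "int ^ 'n ^ 'n"
  assumes gcm: "symmetric_gcm A"
begin

abbreviation (input) W where "W \<equiv> reflection_product A"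
abbreviation (input) ell where "ell js \<equiv> weyl_length A (reflection_product A js)"

lemma diag: "A $ i $ i = 2"
  using gcm by (simp add: symmetric_gcm_def)

lemma entry_sym: "A $ i $ j = A $ j $ i"
proof -
  have "Finite_Cartesian_Product.transpose A $ i $ j = A $ i $ j"
    using gcm by (simp add: symmetric_gcm_def)
  then show ?thesis by (simp add: Finite_Cartesian_Product.transpose_def)
qed

lemma off_diag: "i \<noteq> j \<Longrightarrow> A $ i $ j \<le> 0"
  using gcm by (simp add: symmetric_gcm_def)

lemma matrix_axis: "(A *v axis i 1) $ j = A $ j $ i"
  by (simp add: matrix_vector_mult_def axis_def if_distrib cong: if_cong)

lemma pairing_minus: "(A *v (x - c *s y)) $ j = (A *v x) $ j - c * (A *v y) $ j"
  by (simp add: matrix_vector_mult_def algebra_simps sum_subtractf sum_distrib_left)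

lemma pairing_reflection:
  "(A *v simple_reflection A i x) $ j = (A *v x) $ j - (A *v x) $ i * A $ j $ i"
  by (simp add: simple_reflection_def pairing_minus matrix_axis)

lemma reflection_nth:
  "simple_reflection A i x $ k = x $ k - (if k = i then (A *v x) $ i else 0)"
  by (simp add: simple_reflection_def axis_def)

lemma word_Nil: "W [] = id"
  by (simp add: reflection_product_def one_GL_lattice)

lemma word_in_GL: "W js \<in> carrier GL_lattice"
proof (induction js)
  interpret GL: group "GL_lattice :: (int ^ 'n \<Rightarrow> int ^ 'n) monoid"
    by (rule group_GL_lattice)
  case Nil
  show ?case by (simp add: reflection_product_def)
next
  interpret GL: group "GL_lattice :: (int ^ 'n \<Rightarrow> int ^ 'n) monoid"
    by (rule group_GL_lattice)
  case (Cons j js)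
  then show ?case
    by (simp add: reflection_product_def simple_reflection_in_GL [OF gcm])
qed

lemma word_Cons: "W (j # js) = simple_reflection A j \<circ> W js"
  using mult_GL_lattice [OF simple_reflection_in_GL [OF gcm, of j] word_in_GL [of js]]
  by (simp add: reflection_product_def)

lemma word_append: "W (js @ ks) = W js \<circ> W ks"
  by (induction js) (simp_all add: word_Nil word_Cons comp_assoc)

lemma word_single: "W [j] = simple_reflection A j"
  by (simp add: word_Nil word_Cons)

lemma word_repeat: "W (js @ [i, i]) = W js"
  by (rule ext) (simp add: word_append word_Cons word_Nil simple_reflection_involution [OF gcm])

lemma word_snoc_cancel:
  assumes "W js = W (ks @ [i])"
  shows "W (js @ [i]) = W ks"
proof -
  have "W (js @ [i]) = W ((ks @ [i]) @ [i])"
    by (simp only: word_append [of js] word_append [of "ks @ [i]"] assms)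
  then show ?thesis
    using word_repeat [of ks i] by simp
qed

lemma word_rev_cancel: "W (rev js) (W js x) = x"
  by (induction js)
    (simp_all add: word_append word_Nil word_Cons simple_reflection_involution [OF gcm])

lemma word_add: "W js (x + y) = W js x + W js y"
  using word_in_GL [of js] by (simp add: carrier_GL_lattice)

lemma word_scale: "W js (c *s x) = c *s W js x"
proof (induction js)
  case (Cons j js)
  have "simple_reflection A j (c *s z) = c *s simple_reflection A j z" for z
    by (simp add: simple_reflection_def vec_eq_iff matrix_vector_mult_def axis_def
        algebra_simps sum_distrib_left)
  then show ?case by (simp add: word_Cons Cons)
qed (simp add: word_Nil)

lemma word_uminus: "W js (- x) = - W js x"
  using word_scale [of js "-1" x] by (simp add: vector_sneg_minus1 [symmetric])

lemma reflection_self: "simple_reflection A i (axis i 1) = - axis i 1"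
  by (simp add: simple_reflection_axis diag vec_eq_iff)

lemma word_snoc_root: "W (js @ [i]) (axis i 1) = - W js (axis i 1)"
  by (simp add: word_append word_single reflection_self word_uminus)

lemma cartan_norm_reflection: "cartan_norm A (simple_reflection A i x) = cartan_norm A x"
proof -
  define c where "c = (A *v x) $ i"
  have col: "(\<Sum>j\<in>UNIV. x $ j * A $ j $ i) = c"
    by (simp add: c_def matrix_vector_mult_def entry_sym [of i] mult.commute)
  have "cartan_norm A (simple_reflection A i x)
      = (\<Sum>j\<in>UNIV. (x $ j - (if j = i then c else 0)) * ((A *v x) $ j - c * A $ j $ i))"
    by (simp add: cartan_norm_def pairing_reflection reflection_nth c_def cong: if_cong)
  also have "\<dots> = (\<Sum>j\<in>UNIV. x $ j * (A *v x) $ j - c * (x $ j * A $ j $ i)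
      - (if j = i then c * (c - c * 2) else 0))"
    by (rule sum.cong) (auto simp: algebra_simps c_def diag)
  also have "\<dots> = cartan_norm A x - c * (\<Sum>j\<in>UNIV. x $ j * A $ j $ i) + c * c"
    by (simp add: sum_subtractf sum_distrib_left [symmetric] cartan_norm_def)
  finally show ?thesis
    by (simp add: col)
qed

lemma cartan_norm_word: "cartan_norm A (W js x) = cartan_norm A x"
  by (induction js) (simp_all add: word_Nil word_Cons cartan_norm_reflection)

text \<open>With the invariance of the form, this shows that the only nonnegative multiple of a basis vector
that is a root is the basis vector itself.\<close>

lemma cartan_norm_axis: "cartan_norm A (c *s axis i 1) = 2 * c * c"
proof -
  have "(A *v (c *s axis i 1)) $ i = c * 2"
    by (simp add: matrix_vector_mult_def axis_def diag if_distrib cong: if_cong)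
  then have "cartan_norm A (c *s axis i 1) = (\<Sum>j\<in>UNIV. if j = i then c * (c * 2) else 0)"
    unfolding cartan_norm_def by (intro sum.cong) (simp_all add: axis_def)
  then show ?thesis by simp
qed

section \<open>Length and the sign of roots\<close>

lemma length_le: "ell js \<le> length js"
  unfolding weyl_length_def by (rule Least_le) blast

lemma reduced_word: obtains ks where "W ks = W js" "length ks = ell js"
proof -
  have "\<exists>ks. length ks = ell js \<and> W ks = W js"
    unfolding weyl_length_def by (rule LeastI_ex) blast
  then show ?thesis using that by blast
qed

lemma length_append_le: "ell (js @ ks) \<le> ell js + length ks"
proof -
  obtain zs where zs: "W zs = W js" "length zs = ell js"
    by (rule reduced_word)
  have "ell (js @ ks) = ell (zs @ ks)"
    by (simp add: word_append zs)
  also have "\<dots> \<le> length (zs @ ks)"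
    by (rule length_le)
  finally show ?thesis by (simp add: zs)
qed

lemma length_rev: "ell (rev js) = ell js"
proof -
  have rev_cong: "W (rev js) = W (rev ks)" if "W js = W ks" for js ks
  proof
    fix x
    have "W (rev js) x = W (rev js) (W js (W (rev ks) x))"
      using word_rev_cancel [of "rev ks" x] that by simp
    then show "W (rev js) x = W (rev ks) x"
      by (simp add: word_rev_cancel)
  qed
  have le: "ell (rev js) \<le> ell js" for js
  proof -
    obtain ks where "W ks = W js" "length ks = ell js"
      by (rule reduced_word)
    then show ?thesis
      using length_le [of "rev ks"] rev_cong [of ks js] by simp
  qed
  show ?thesis
    using le [of js] le [of "rev js"] by simp
qed

lemma braid_commute:
  assumes "A $ s $ t = 0"
  shows "W [s, t] = W [t, s]"
proof -
  have "s \<noteq> t" using assms diag [of t] by auto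
  moreover have "A $ t $ s = 0" using assms entry_sym [of t s] by simp
  ultimately show ?thesis
    using assms
    by (auto simp: fun_eq_iff word_Cons word_Nil vec_eq_iff reflection_nth pairing_reflection)
qed

lemma braid_three:
  assumes "A $ s $ t = -1"
  shows "W [t, s, t] = W [s, t, s]"
proof -
  have "s \<noteq> t" using assms diag [of t] by auto
  moreover have "A $ t $ s = -1" using assms entry_sym [of t s] by simp
  ultimately show ?thesis
    using assms
    by (auto simp: fun_eq_iff word_Cons word_Nil vec_eq_iff reflection_nth pairing_reflection diag)
qed

lemma word_combination:
  "W js (a *s x + b *s y) = a *s W js x + b *s W js y"
  by (simp add: word_add word_scale)

lemma reflection_plane_left:
  "simple_reflection A s (a *s axis s 1 + b *s axis t 1)
    = (- a - b * A $ s $ t) *s axis s 1 + b *s axis t 1"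
  using word_combination [of "[s]" a "axis s 1" b "axis t 1"]
  by (simp add: word_single reflection_self simple_reflection_axis diag vec_eq_iff algebra_simps)

lemma reflection_plane_right:
  "simple_reflection A t (a *s axis s 1 + b *s axis t 1)
    = a *s axis s 1 + (- b - a * A $ s $ t) *s axis t 1"
  using reflection_plane_left [of t b a s] by (simp add: add.commute entry_sym [of t s])

text \<open>The rank two subgroup is infinite here, and the two coordinates never decrease: each
reflection replaces the smaller coordinate \<open>b\<close> by \<open>- b - a A\<^bsub>st\<^esub> \<ge> 2 a - b \<ge> a\<close>.\<close>

lemma alternating_root:
  assumes "A $ s $ t \<le> -2"
  shows "\<exists>a b. 0 \<le> a \<and> 0 \<le> b \<and> (if even p then b \<le> a else a \<le> b) \<and>
    W (alternating s t p) (axis s 1) = a *s axis s 1 + b *s axis t 1"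
proof (induction p)
  case 0
  show ?case by (intro exI [of _ 1] exI [of _ 0]) (simp add: word_Nil)
next
  case (Suc p)
  then obtain a b where ab: "0 \<le> a" "0 \<le> b" "if even p then b \<le> a else a \<le> b"
    "W (alternating s t p) (axis s 1) = a *s axis s 1 + b *s axis t 1"
    by blast
  show ?case
  proof (cases "even p")
    case True
    have "2 * a \<le> - (a * A $ s $ t)"
      using mult_left_mono [OF assms, of a] ab(1) by simp
    then show ?thesis
      using ab True
      by (intro exI [of _ a] exI [of _ "- b - a * A $ s $ t"])
        (simp add: alternating_Suc_left word_Cons reflection_plane_right del: alternating.simps)
  next
    case False
    have "2 * b \<le> - (b * A $ s $ t)"
      using mult_left_mono [OF assms, of b] ab(2) by simp
    then show ?thesis
      using ab False
      by (intro exI [of _ "- a - b * A $ s $ t"] exI [of _ b])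
        (simp add: alternating_Suc_left word_Cons reflection_plane_left del: alternating.simps)
  qed
qed

text \<open>Induction on the length of \<open>w = W js\<close>. Among the reduced words of \<open>w\<close> take one with the
longest alternating tail in \<open>s\<close> and the last letter \<open>t\<close>, so that \<open>w = v u\<close> with \<open>u\<close> the tail.
Multiplying \<open>v\<close> on the right by \<open>s\<close> or \<open>t\<close> cannot shorten it, because this would shorten \<open>w\<close>
or lengthen the tail; so by induction \<open>v\<close> sends both basis vectors to nonnegative vectors. It
remains to see that \<open>u\<close> sends the basis vector of \<open>s\<close> to a nonnegative combination of the two.
This is a computation in rank two. When the rank two subgroup is finite, the braid relation
bounds the tail: a longer one could be rewritten to end in \<open>s\<close>, contrary to the hypothesis.\<close>

lemma root_nonneg_if_not_shorter:
  assumes "\<not> ell (js @ [s]) < ell js"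
  shows "nonneg_vec (W js (axis s 1))"
  using assms
proof (induction "ell js" arbitrary: js s rule: less_induct)
  case less
  show ?case
  proof (cases "ell js = 0")
    case True
    then have "W js = id"
      by (metis reduced_word length_0_conv word_Nil)
    then show ?thesis by (simp add: nonneg_axis)
  next
    case False
    obtain ks where ks: "W ks = W js" "length ks = ell js"
      by (rule reduced_word)
    with False obtain ks' t where ks': "ks = ks' @ [t]"
      by (metis list.size(3) rev_exhaust)
    have st: "s \<noteq> t"
    proof
      assume "s = t"
      have "ell (js @ [s]) = ell ks'"
        using \<open>s = t\<close> ks ks' word_snoc_cancel [of js ks' t] by simp
      then show False
        using less.prems length_le [of ks'] ks ks' by simp
    qed
    define Q where "Q p \<longleftrightarrow> (\<exists>zs. W (zs @ alternating s t p) = W js \<and> length zs + p = ell js)" for p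
    have "Q 1"
      using ks ks' unfolding Q_def by (intro exI [of _ ks']) simp
    moreover have bound: "\<forall>p. Q p \<longrightarrow> p \<le> ell js"
      unfolding Q_def by auto
    ultimately obtain p where p: "Q p" "1 \<le> p" "\<not> Q (Suc p)"
      by (metis GreatestI_nat Greatest_le_nat Suc_n_not_le_n)
    then obtain zs where zs: "W (zs @ alternating s t p) = W js" "length zs + p = ell js"
      unfolding Q_def by blast
    have zs_min: "length zs \<le> ell zs"
      using length_append_le [of zs "alternating s t p"] zs by simp
    then have shorter: "ell zs < ell js"
      using length_le [of zs] zs p by simp
    \<comment> \<open>\<open>x\<close> is the first letter of the tail and \<open>y\<close> the letter that would prolong it to the left.\<close>
    define x y where "x = (if even p then s else t)" and "y = (if even p then t else s)"
    obtain p' where p': "p = Suc p'"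
      using p by (metis Suc_le_D One_nat_def)
    have ny: "nonneg_vec (W zs (axis y 1))"
    proof (rule less.hyps [OF shorter], rule notI)
      assume lt: "ell (zs @ [y]) < ell zs"
      obtain us where us: "W us = W (zs @ [y])" "length us = ell (zs @ [y])"
        by (rule reduced_word)
      have eq: "W (us @ alternating s t (Suc p)) = W js"
        using us word_repeat [of zs y] zs
        by (simp add: alternating_Suc_left y_def [symmetric] word_append word_Cons word_Nil
            comp_assoc [symmetric] del: alternating.simps)
      have "ell js \<le> length us + Suc p"
        using length_le [of "us @ alternating s t (Suc p)"] unfolding eq by simp
      moreover have "length us + Suc p \<le> ell js"
        using us lt length_le [of zs] zs by linarith
      ultimately have "Q (Suc p)"
        using eq unfolding Q_def by (intro exI [of _ us]) simp
      with p show False by simp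
    qed
    have nx: "nonneg_vec (W zs (axis x 1))"
    proof (rule less.hyps [OF shorter], rule notI)
      assume lt: "ell (zs @ [x]) < ell zs"
      have "W js = W ((zs @ [x]) @ alternating s t p')"
        using zs p' by (cases "even p'") (simp_all add: alternating_Suc_left x_def del: alternating.simps)
      then have "ell js \<le> ell (zs @ [x]) + p'"
        using length_append_le [of "zs @ [x]" "alternating s t p'"] by simp
      then show False
        using lt zs p' length_le [of zs] by linarith
    qed
    have ns: "nonneg_vec (W zs (axis s 1))" and nt: "nonneg_vec (W zs (axis t 1))"
      using nx ny by (auto simp: x_def y_def split: if_splits)
    have not_ending_s: False if "W js = W (us @ [s])" "length us < ell js" for us
    proof -
      have "ell (js @ [s]) = ell us"
        using that word_snoc_cancel [of js us s] by simp
      then show False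
        using less.prems that length_le [of us] by simp
    qed
    have "\<exists>a b. 0 \<le> a \<and> 0 \<le> b \<and>
        W (alternating s t p) (axis s 1) = a *s axis s 1 + b *s axis t 1"
    proof -
      consider "A $ s $ t \<le> -2" | "A $ s $ t = -1" | "A $ s $ t = 0"
        using off_diag [OF st] by linarith
      then show ?thesis
      proof cases
        case 1
        then show ?thesis using alternating_root by metis
      next
        case 2
        have "p < 3"
        proof (rule ccontr)
          assume "\<not> p < 3"
          then obtain r where r: "p = Suc (Suc (Suc r))"
            by (metis numeral_3_eq_3 not_less le_Suc_ex add_Suc_shift plus_nat.simps(2) add_Suc)
          have "W js = W ((zs @ alternating t s r) @ [t, s, t])"
            using zs r by simp
          also have "\<dots> = W ((zs @ alternating t s r @ [s, t]) @ [s])"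
            using braid_three [OF 2] by (simp add: word_append word_Cons word_Nil comp_assoc)
          finally show False
            by (rule not_ending_s) (use zs r in simp)
        qed
        then consider "p = 1" | "p = 2" using p by linarith
        then show ?thesis
        proof cases
          assume "p = 1"
          then show ?thesis
            using 2 st reflection_plane_right [of t 1 s 0]
            by (intro exI [of _ 1] exI [of _ 1]) (simp add: word_single)
        next
          assume "p = 2"
          then show ?thesis
            using 2 st reflection_plane_right [of t 1 s 0] reflection_plane_left [of s 1 1 t]
            by (intro exI [of _ 0] exI [of _ 1])
              (simp add: word_single word_Cons word_Nil numeral_2_eq_2)
        qed
      next
        case 3
        have "p < 2"
        proof (rule ccontr)
          assume "\<not> p < 2"
          then obtain r where r: "p = Suc (Suc r)"
            by (metis add_2_eq_Suc le_Suc_ex not_less)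
          have "W js = W ((zs @ alternating s t r) @ [s, t])"
            using zs r by simp
          also have "\<dots> = W ((zs @ alternating s t r @ [t]) @ [s])"
            using braid_commute [OF 3] by (simp add: word_append word_Cons word_Nil comp_assoc)
          finally show False
            by (rule not_ending_s) (use zs r in simp)
        qed
        then have "p = 1" using p by linarith
        then show ?thesis
          using 3 reflection_plane_right [of t 1 s 0]
          by (intro exI [of _ 1] exI [of _ 0]) (simp add: word_single)
      qed
    qed
    then obtain a b where "0 \<le> a" "0 \<le> b"
        "W (alternating s t p) (axis s 1) = a *s axis s 1 + b *s axis t 1"
      by blast
    moreover have "W js (axis s 1) = W zs (W (alternating s t p) (axis s 1))"
      using zs by (simp add: word_append fun_eq_iff)
    ultimately show ?thesis
      using ns nt by (simp add: word_combination nonneg_combination)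
  qed
qed

text \<open>The previous lemma for \<open>js @ [i]\<close>, whose last letter sends \<open>\<alpha>\<^sub>i\<close> to \<open>- \<alpha>\<^sub>i\<close>.\<close>

lemma root_nonpos_if_not_longer:
  assumes "\<not> ell js < ell (js @ [i])"
  shows "nonneg_vec (- W js (axis i 1))"
proof -
  have "W ((js @ [i]) @ [i]) = W js"
    using word_repeat by simp
  with assms have "nonneg_vec (W (js @ [i]) (axis i 1))"
    by (intro root_nonneg_if_not_shorter) simp
  then show ?thesis by (simp add: word_snoc_root)
qed

lemma root_nonneg_or_nonpos:
  "nonneg_vec (W js (axis i 1)) \<or> nonneg_vec (- W js (axis i 1))"
  using root_nonneg_if_not_shorter [of js i] root_nonpos_if_not_longer [of js i] by linarith

lemma root_nonzero: "W js (axis i 1) \<noteq> 0"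
proof
  assume "W js (axis i 1) = 0"
  then have "axis i 1 = (0 :: int ^ 'n)"
    by (metis word_rev_cancel word_scale vector_smult_lzero)
  then show False by (simp add: axis_eq_0_iff)
qed

lemma longer_if_root_nonneg:
  assumes "nonneg_vec (W js (axis i 1))"
  shows "ell js < ell (js @ [i])"
proof (rule ccontr)
  assume "\<not> ?thesis"
  then have "nonneg_vec (- W js (axis i 1))"
    by (rule root_nonpos_if_not_longer)
  with assms have "W js (axis i 1) = 0"
    by (auto simp: nonneg_vec_def vec_eq_iff intro: antisym)
  with root_nonzero show False by simp
qed

lemma reduced_if_roots_nonneg:
  assumes "\<And>p i q. js = p @ i # q \<Longrightarrow> nonneg_vec (W p (axis i 1))"
  shows "ell js = length js"
  using assms
proof (induction js rule: rev_induct)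
  case Nil
  show ?case using length_le [of "[]"] by simp
next
  case (snoc i js)
  have "ell js = length js"
    by (rule snoc.IH) (use snoc.prems in simp)
  moreover have "ell js < ell (js @ [i])"
    by (rule longer_if_root_nonneg) (use snoc.prems in simp)
  ultimately show ?case
    using length_le [of "js @ [i]"] by simp
qed

text \<open>Apply the letters of \<open>p\<close> one by one from the right. Where the root first turns negative, a
single reflection makes a nonnegative root nonpositive. It changes only one coordinate, so that
root is supported there and, having norm 2, is the basis vector of the reflecting letter.\<close>

lemma negative_root_source:
  assumes "\<not> nonneg_vec (W p (axis t 1))"
  shows "\<exists>a i b. p = a @ i # b \<and> W p (axis t 1) = - W a (axis i 1)"
  using assms
proof (induction p)
  case Nil
  then show ?case by (simp add: word_Nil nonneg_axis)
next
  case (Cons i p)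
  show ?case
  proof (cases "nonneg_vec (W p (axis t 1))")
    case False
    then obtain a j b where "p = a @ j # b" "W p (axis t 1) = - W a (axis j 1)"
      using Cons.IH by blast
    then have "i # p = (i # a) @ j # b \<and> W (i # p) (axis t 1) = - W (i # a) (axis j 1)"
      using word_uminus [of "[i]"] by (simp add: word_Cons word_Nil)
    then show ?thesis by blast
  next
    case True
    define g where "g = W p (axis t 1)"
    have neg: "nonneg_vec (- simple_reflection A i g)"
      using root_nonneg_or_nonpos [of "i # p" t] Cons.prems by (simp add: word_Cons g_def)
    have "g $ k = 0" if "k \<noteq> i" for k
    proof -
      have "0 \<le> g $ k"
        using True unfolding g_def nonneg_vec_def by blast
      moreover have "g $ k \<le> 0"
        using neg that by (auto simp: nonneg_vec_def reflection_nth dest: spec [of _ k])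
      ultimately show ?thesis by simp
    qed
    then have g: "g = g $ i *s axis i 1"
      by (auto simp: vec_eq_iff axis_def)
    have "2 * (g $ i) * (g $ i) = 2 * 1 * 1"
      using cartan_norm_axis [of "g $ i" i] g cartan_norm_word [of p "axis t 1"]
        cartan_norm_axis [of 1 t]
      by (simp add: g_def)
    moreover have "0 \<le> g $ i"
      using True unfolding g_def nonneg_vec_def by blast
    ultimately have "g $ i = 1"
      by (simp add: zmult_eq_1_iff)
    with g have "g = axis i 1" by simp
    then have "i # p = [] @ i # p \<and> W (i # p) (axis t 1) = - W [] (axis i 1)"
      by (simp add: word_Cons word_Nil g_def [symmetric] reflection_self)
    then show ?thesis by blast
  qed
qed


section \<open>Positive definite matrices have finite Weyl groups\<close>

lemma word_sum: "W js (\<Sum>i\<in>S. f i) = (\<Sum>i\<in>S. W js (f i))" if "finite S"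
  using that
proof induction
  case empty
  show ?case using word_scale [of js 0 0] by simp
qed (simp add: word_add)

lemma word_eqI:
  assumes "\<And>i. W js (axis i 1) = W ks (axis i 1)"
  shows "W js = W ks"
proof
  fix z
  have expand: "W us z = (\<Sum>i\<in>UNIV. z $ i *s W us (axis i 1))" for us
    using word_sum [of UNIV us "\<lambda>i. z $ i *s axis i 1"]
    by (simp add: basis_expansion word_scale)
  show "W js z = W ks z"
    using expand [of js] expand [of ks] assms by simp
qed

text \<open>The roots are lattice points of norm 2, hence bounded and finite in number, and an element of the
group is determined by the roots to which it sends the basis.\<close>

lemma finite_weyl_group_if_positive_definite:
  fixes l :: real
  assumes "0 < l"
    and "\<And>z. l * (\<Sum>i\<in>UNIV. (real_of_int (z $ i))\<^sup>2) \<le> real_of_int (cartan_norm A z)"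
  shows "finite (weyl_group A)"
proof -
  define N where "N = \<lceil>2 / l\<rceil>"
  define B :: "(int ^ 'n) set" where "B = {z. \<forall>k. z $ k \<in> {-N..N}}"
  have "B \<subseteq> vec_lambda ` (UNIV \<rightarrow>\<^sub>E {-N..N})"
  proof
    fix z assume "z \<in> B"
    then have "vec_nth z \<in> (UNIV \<rightarrow>\<^sub>E {-N..N})"
      by (simp add: B_def PiE_UNIV_domain)
    then show "z \<in> vec_lambda ` (UNIV \<rightarrow>\<^sub>E {-N..N})"
      by (metis imageI vec_nth_inverse)
  qed
  then have "finite B"
    by (rule finite_subset) (intro finite_imageI finite_PiE, auto)
  have root_bounded: "W js (axis i 1) \<in> B" for js i
  proof -
    define z where "z = W js (axis i 1)"
    have z2: "cartan_norm A z = 2"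
      using cartan_norm_axis [of 1 i] by (simp add: z_def cartan_norm_word)
    have "\<bar>z $ k\<bar> \<le> N" for k
    proof -
      have "(real_of_int (z $ k))\<^sup>2 \<le> (\<Sum>i\<in>UNIV. (real_of_int (z $ i))\<^sup>2)"
        by (rule member_le_sum) auto
      then have "l * (real_of_int (z $ k))\<^sup>2 \<le> l * (\<Sum>i\<in>UNIV. (real_of_int (z $ i))\<^sup>2)"
        using \<open>0 < l\<close> by (simp add: mult_left_mono)
      also have "\<dots> \<le> 2"
        using assms(2) [of z] z2 by simp
      finally have "l * (real_of_int (z $ k))\<^sup>2 \<le> 2" .
      then have "(real_of_int (z $ k))\<^sup>2 \<le> 2 / l"
        using \<open>0 < l\<close> by (simp add: field_simps)
      then have "(z $ k)\<^sup>2 \<le> N"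
        unfolding N_def by (metis ceiling_mono ceiling_of_int of_int_power)
      moreover have "\<bar>z $ k\<bar> \<le> (z $ k)\<^sup>2"
      proof (cases "z $ k = 0")
        case False
        then have "1 \<le> \<bar>z $ k\<bar>" by linarith
        then show ?thesis
          using self_le_power [of "\<bar>z $ k\<bar>" 2] by simp
      qed simp
      ultimately show ?thesis by simp
    qed
    then show ?thesis
      by (simp add: B_def z_def [symmetric] abs_le_iff minus_le_iff)
  qed
  have "inj_on (\<lambda>w j. w (axis j 1)) (range W)"
  proof (rule inj_onI)
    fix w w' :: "int ^ 'n \<Rightarrow> int ^ 'n"
    assume "w \<in> range W" "w' \<in> range W" and eq: "(\<lambda>j. w (axis j 1)) = (\<lambda>j. w' (axis j 1))"
    then obtain js ks where "w = W js" "w' = W ks"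
      by blast
    then show "w = w'"
      using word_eqI [of js ks] fun_cong [OF eq] by simp
  qed
  moreover have "(\<lambda>w j. w (axis j 1)) ` range W \<subseteq> (UNIV \<rightarrow>\<^sub>E B)"
    using root_bounded by (auto simp: PiE_UNIV_domain)
  then have "finite ((\<lambda>w j. w (axis j 1)) ` range W)"
    by (rule finite_subset) (intro finite_PiE, auto simp: \<open>finite B\<close>)
  ultimately show ?thesis
    using finite_imageD weyl_group_eq_products [OF gcm] by metis
qed

end

section \<open>A functional that stays positive along powers of a Coxeter element\<close>

text \<open>This is \<open>z\<^sup>T E x\<close>, where \<open>E\<close> has ones on the diagonal, the entries of \<open>A\<close> where the column
index precedes the row index in \<open>us\<close>, and zeros elsewhere. For a symmetric Cartan matrix
\<open>E + E\<^sup>T = A\<close>, so \<open>E\<close> is a form of Euler type for the orientation given by \<open>us\<close>.\<close>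

definition ordered_functional ::
    "int ^ 'n ^ 'n \<Rightarrow> 'n list \<Rightarrow> ('n \<Rightarrow> real) \<Rightarrow> int ^ 'n \<Rightarrow> real" where
  "ordered_functional A us x z = (\<Sum>i\<in>UNIV. real_of_int (z $ i) *
     (x i + (\<Sum>j\<in>set (takeWhile (\<lambda>j. j \<noteq> i) us). real_of_int (A $ i $ j) * x j)))"

lemma ordered_functional_axis:
  assumes "us = p @ i # q" and "i \<notin> set p"
  shows "ordered_functional A us x (axis i 1) =
    x i + (\<Sum>j\<in>set p. real_of_int (A $ i $ j) * x j)"
proof -
  have "takeWhile (\<lambda>j. j \<noteq> i) us = p"
    unfolding assms(1) using assms(2) by (subst takeWhile_append2) auto
  then show ?thesis
    by (simp add: ordered_functional_def axis_def if_distrib if_distribR cong: if_cong)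
qed

lemma ordered_functional_minus:
  "ordered_functional A us x (z - c *s y) =
    ordered_functional A us x z - real_of_int c * ordered_functional A us x y"
  by (simp add: ordered_functional_def sum_distrib_left left_diff_distrib mult.assoc
      flip: sum_subtractf)

lemma ordered_functional_uminus:
  "ordered_functional A us x (- z) = - ordered_functional A us x z"
  by (simp add: ordered_functional_def sum_negf)

context
  fixes A :: "int ^ 'n ^ 'n" and us :: "'n list" and x :: "'n \<Rightarrow> real"
  assumes gcm: "symmetric_gcm A"
    and us: "distinct us" "set us = UNIV"
    and x_pos: "\<And>i. 0 < x i"
    and x_super: "\<And>i. (\<Sum>j\<in>UNIV. real_of_int (A $ i $ j) * x j) \<le> 0"
begin

abbreviation (input) W' where "W' \<equiv> reflection_product A"
abbreviation (input) phi where "phi \<equiv> ordered_functional A us x"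

text \<open>After the letters before \<open>i\<close> the functional takes the value \<open>x i\<close> on the basis vector of
\<open>i\<close>: the terms that its definition attaches to the earlier indices are those that the earlier
reflections remove. So the reflection in \<open>i\<close> contributes exactly the term of \<open>i\<close>.\<close>

lemma functional_prefix:
  assumes "us = p @ q"
  shows "phi (W' p z) = phi z - (\<Sum>j\<in>set p. x j * real_of_int ((A *v z) $ j))"
  using assms
proof (induction p arbitrary: q z rule: rev_induct)
  case Nil
  show ?case by (simp add: word_Nil [OF gcm])
next
  case (snoc i p)
  have i: "i \<notin> set p" and split: "us = p @ i # q"
    using snoc.prems us by auto
  define c where "c = (A *v z) $ i"
  have "phi (W' (p @ [i]) z) = phi (W' p (simple_reflection A i z))"
    by (simp add: word_append [OF gcm] word_single [OF gcm])
  also have "\<dots> = phi (simple_reflection A i z)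
      - (\<Sum>j\<in>set p. x j * real_of_int ((A *v simple_reflection A i z) $ j))"
    by (rule snoc.IH [OF split])
  also have "phi (simple_reflection A i z) =
      phi z - c * (x i + (\<Sum>j\<in>set p. real_of_int (A $ i $ j) * x j))"
    by (simp add: simple_reflection_def ordered_functional_minus c_def
        ordered_functional_axis [OF split i])
  also have "(\<Sum>j\<in>set p. x j * real_of_int ((A *v simple_reflection A i z) $ j)) =
      (\<Sum>j\<in>set p. x j * real_of_int ((A *v z) $ j))
        - c * (\<Sum>j\<in>set p. real_of_int (A $ i $ j) * x j)"
    by (simp add: pairing_reflection [OF gcm] entry_sym [OF gcm, of i] c_def right_diff_distrib
        sum_subtractf sum_distrib_left mult_ac)
  finally show ?case
    using i by (simp add: algebra_simps c_def)
qed

lemma functional_initial_root: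
  assumes "us = p @ i # q"
  shows "phi (W' p (axis i 1)) = x i"
proof -
  have i: "i \<notin> set p"
    using assms us by auto
  show ?thesis
    unfolding functional_prefix [OF assms] ordered_functional_axis [OF assms i]
    by (simp add: matrix_axis [OF gcm] entry_sym [OF gcm, of i] mult.commute)
qed

lemma functional_coxeter_mono:
  assumes "nonneg_vec z"
  shows "phi z \<le> phi (W' us z)"
proof -
  have "(\<Sum>j\<in>UNIV. x j * real_of_int ((A *v z) $ j))
      = (\<Sum>j\<in>UNIV. \<Sum>k\<in>UNIV. real_of_int (z $ k) * (real_of_int (A $ k $ j) * x j))"
    by (simp add: matrix_vector_mult_def sum_distrib_left mult_ac entry_sym [OF gcm])
  also have "\<dots> = (\<Sum>k\<in>UNIV. real_of_int (z $ k) * (\<Sum>j\<in>UNIV. real_of_int (A $ k $ j) * x j))"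
    by (subst sum.swap) (simp add: sum_distrib_left)
  also have "\<dots> \<le> 0"
    using assms x_super by (simp add: sum_nonpos mult_nonneg_nonpos nonneg_vec_def)
  finally show ?thesis
    using functional_prefix [of us "[]" z] us by simp
qed

text \<open>The two claims are proved together by induction on the position. Positivity of the functional
comes from the first period, or from one period earlier, where the root is already known to be
nonnegative. A root that is not nonnegative would be the negative of an earlier one, on which the
functional is positive as well.\<close>

lemma periodic_roots_positive:
  assumes "concat (replicate k us) = p @ i # q"
  shows "nonneg_vec (W' p (axis i 1)) \<and> 0 < phi (W' p (axis i 1))"
  using assms
proof (induction "length p" arbitrary: k p i q rule: less_induct)
  case less
  obtain k' where k: "k = Suc k'"
    using less.prems by (cases k) auto
  have pos: "0 < phi (W' p (axis i 1))"
  proof (cases "length p < length us")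
    case True
    then obtain r where r: "us = p @ r" "r \<noteq> []" "r @ concat (replicate k' us) = i # q"
      using less.prems k by (auto simp: append_eq_append_conv2)
    then obtain q' where "us = p @ i # q'"
      by (cases r) auto
    then show ?thesis
      using functional_initial_root x_pos by simp
  next
    case False
    then obtain p' where p': "p = us @ p'" "concat (replicate k' us) = p' @ i # q"
      using less.prems k by (auto simp: append_eq_append_conv2 Cons_eq_append_conv)
    have "us \<noteq> []"
      using us by auto
    then have "nonneg_vec (W' p' (axis i 1)) \<and> 0 < phi (W' p' (axis i 1))"
      using less.hyps [OF _ p'(2)] p'(1) by simp
    then show ?thesis
      using functional_coxeter_mono [of "W' p' (axis i 1)"] p'(1)
      by (simp add: word_append [OF gcm])
  qed
  moreover have "nonneg_vec (W' p (axis i 1))"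
  proof (rule ccontr)
    assume "\<not> ?thesis"
    then obtain a j b where ab: "p = a @ j # b" "W' p (axis i 1) = - W' a (axis j 1)"
      using negative_root_source [OF gcm] by blast
    then have "0 < phi (W' a (axis j 1))"
      using less.hyps [of a k j "b @ i # q"] less.prems by simp
    then show False
      using pos ab by (simp add: ordered_functional_uminus)
  qed
  ultimately show ?case by simp
qed

lemma coxeter_powers_reduced:
  "weyl_length A (W' (concat (replicate k us))) = k * length us"
proof -
  have "weyl_length A (W' (concat (replicate k us))) = length (concat (replicate k us))"
    by (rule reduced_if_roots_nonneg [OF gcm]) (use periodic_roots_positive in blast)
  then show ?thesis
    by (simp add: length_concat sum_list_replicate)
qed

end

section \<open>A positive vector with nonpositive image when the group is infinite\<close>

lemma minimizer_is_eigenvector: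
  fixes B :: "real ^ 'n ^ 'n"
  assumes symm: "\<And>y z. y \<bullet> (B *v z) = z \<bullet> (B *v y)"
    and le: "\<And>y. l * (y \<bullet> y) \<le> y \<bullet> (B *v y)"
    and eq: "x \<bullet> (B *v x) = l * (x \<bullet> x)"
  shows "B *v x = l *\<^sub>R x"
proof (rule ccontr)
  define g where "g = B *v x - l *\<^sub>R x"
  define K where "K = g \<bullet> (B *v g) - l * (g \<bullet> g)"
  assume "\<not> ?thesis"
  then have g: "0 < g \<bullet> g"
    by (simp add: g_def)
  have K: "0 \<le> K"
    using le [of g] by (simp add: K_def)
  have gx: "g \<bullet> (B *v x) = g \<bullet> g + l * (g \<bullet> x)"
    by (simp add: g_def inner_diff_right algebra_simps)
  \<comment> \<open>Moving from \<open>x\<close> by \<open>t\<close> against the residual \<open>g\<close> lowers the form minus \<open>l\<close> times the squared norm\<close>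
  \<comment> \<open>by \<open>t (2 (g \<bullet> g) - t K)\<close>; this choice of \<open>t\<close> gives \<open>t K < g \<bullet> g\<close>.\<close>
  define t where "t = (g \<bullet> g) / (K + 1)"
  have t: "0 < t"
    using g K by (simp add: t_def)
  have "t * (K + 1) = g \<bullet> g"
    using K by (simp add: t_def)
  then have tK: "t * K = g \<bullet> g - t"
    by (simp add: distrib_left)
  have norm: "(x - t *\<^sub>R g) \<bullet> (x - t *\<^sub>R g) = x \<bullet> x - 2 * t * (g \<bullet> x) + t * t * (g \<bullet> g)"
    by (simp add: inner_diff_left inner_diff_right inner_commute [of x g] right_diff_distrib mult.assoc)
  have "B *v (x - t *\<^sub>R g) = B *v x - t *\<^sub>R (B *v g)"
    by (simp add: matrix_vector_mult_diff_distrib matrix_vector_mult_scaleR)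
  then have "(x - t *\<^sub>R g) \<bullet> (B *v (x - t *\<^sub>R g))
      = l * (x \<bullet> x) - 2 * t * (g \<bullet> g + l * (g \<bullet> x)) + t * t * (g \<bullet> (B *v g))"
    by (simp add: inner_diff_left inner_diff_right eq gx symm [of x g] right_diff_distrib mult.assoc)
  then have "l * (x \<bullet> x - 2 * t * (g \<bullet> x) + t * t * (g \<bullet> g))
      \<le> l * (x \<bullet> x) - 2 * t * (g \<bullet> g + l * (g \<bullet> x)) + t * t * (g \<bullet> (B *v g))"
    using le [of "x - t *\<^sub>R g"] norm by simp
  then have "t * (2 * (g \<bullet> g)) \<le> t * (t * K)"
    by (simp add: K_def algebra_simps)
  then have "2 * (g \<bullet> g) \<le> t * K"
    using t by (simp add: mult_le_cancel_left_pos)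
  with tK t g show False by simp
qed

lemma quadratic_form_minimum:
  fixes B :: "real ^ 'n ^ 'n"
  obtains l x where "x \<bullet> x = 1" and "x \<bullet> (B *v x) = l" and "\<And>y. l * (y \<bullet> y) \<le> y \<bullet> (B *v y)"
proof -
  let ?S = "sphere (0 :: real ^ 'n) 1"
  have "axis undefined 1 \<in> ?S" by simp
  then have nonempty: "?S \<noteq> {}" by blast
  have "continuous_on ?S (\<lambda>y. y \<bullet> (B *v y))"
    by (intro continuous_on_inner continuous_on_id linear_continuous_on
        matrix_vector_mul_bounded_linear)
  then obtain x where x: "x \<in> ?S"
    and min: "\<And>y. y \<in> ?S \<Longrightarrow> x \<bullet> (B *v x) \<le> y \<bullet> (B *v y)"
    using continuous_attains_inf [OF compact_sphere nonempty] by blast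
  have "(x \<bullet> (B *v x)) * (y \<bullet> y) \<le> y \<bullet> (B *v y)" for y
  proof (cases "y = 0")
    case False
    have "(1 / norm y) *\<^sub>R y \<in> ?S"
      using False by simp
    from min [OF this] have "x \<bullet> (B *v x) \<le> (y \<bullet> (B *v y)) / (norm y * norm y)"
      by (simp add: matrix_vector_mult_scaleR)
    moreover have "y \<bullet> y = norm y * norm y"
      by (simp add: dot_square_norm power2_eq_square)
    moreover have "0 < norm y * norm y"
      using False by simp
    ultimately show ?thesis
      by (simp only: pos_le_divide_eq)
  qed simp
  moreover have "x \<bullet> x = 1"
    using x by (simp add: dot_square_norm)
  ultimately show ?thesis
    using that by blast
qed

text \<open>Otherwise an enumeration that lists \<open>Z\<close> before its complement makes \<open>A\<close> block diagonal.\<close>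

lemma indecomposable_connected:
  fixes A :: "int ^ 'n ^ 'n"
  assumes gcm: "symmetric_gcm A" and ind: "indecomposable A" and "Z \<noteq> {}" and "Z \<noteq> UNIV"
  shows "\<exists>i j. i \<in> Z \<and> j \<notin> Z \<and> A $ i $ j \<noteq> 0"
proof (rule ccontr)
  assume none: "\<not> ?thesis"
  obtain f where f: "bij_betw f {0..<card Z} Z"
    using ex_bij_betw_nat_finite [of Z] by auto
  obtain g where g: "bij_betw g {0..<card (- Z)} (- Z)"
    using ex_bij_betw_nat_finite [of "- Z"] by auto
  define k where "k = card Z"
  define e where "e m = (if m < k then f m else g (m - k))" for m
  have card: "card Z + card (- Z) = CARD('n)"
    using card_Un_disjoint [of Z "- Z"] by simp
  have "card Z \<noteq> 0" "card (- Z) \<noteq> 0"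
    using assms by auto
  then have k: "0 < k" "k < CARD('n)"
    using card unfolding k_def by linarith+
  have e1: "bij_betw e {..<k} Z"
    using f by (subst bij_betw_cong [where g = f]) (auto simp: e_def k_def lessThan_atLeast0)
  have "bij_betw (\<lambda>m. m - k) {k..<CARD('n)} {0..<card (- Z)}"
    by (rule bij_betwI [where g = "\<lambda>m. m + k"]) (use card in \<open>auto simp: k_def\<close>)
  then have "bij_betw (g \<circ> (\<lambda>m. m - k)) {k..<CARD('n)} (- Z)"
    by (rule bij_betw_trans [OF _ g])
  then have e2: "bij_betw e {k..<CARD('n)} (- Z)"
    by (subst bij_betw_cong [where g = "g \<circ> (\<lambda>m. m - k)"]) (auto simp: e_def)
  have "bij_betw e ({..<k} \<union> {k..<CARD('n)}) (Z \<union> - Z)"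
    by (rule bij_betw_combine [OF e1 e2]) simp
  moreover have "{..<k} \<union> {k..<CARD('n)} = {..<CARD('n)}"
    using k by auto
  ultimately have "bij_betw e {..<CARD('n)} UNIV"
    by simp
  moreover have "A $ e i $ e j = 0 \<and> A $ e j $ e i = 0" if "i \<in> {..<k}" "j \<in> {k..<CARD('n)}" for i j
  proof -
    have "e i \<in> Z" "e j \<notin> Z"
      using that bij_betwE [OF e1] bij_betwE [OF e2] by auto
    then show ?thesis
      using none entry_sym [OF gcm, of "e j" "e i"] by auto
  qed
  ultimately show False
    using ind k unfolding indecomposable_def by blast
qed

text \<open>Let \<open>w\<close> minimise the quadratic form on the unit sphere, with minimum \<open>l\<close>. Then \<open>l \<le> 0\<close>, since a
positive definite form gives a finite group. As the off-diagonal entries are nonpositive, replacing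
the coordinates of \<open>w\<close> by their absolute values does not raise the form, so the new vector \<open>x\<close>
is again a minimiser, hence an eigenvector for \<open>l\<close>. If a coordinate of \<open>x\<close> vanishes, its row of
\<open>A x = l x\<close> is a sum of nonpositive terms equal to zero; so the zero set of \<open>x\<close> is not
connected to its complement and must be empty.\<close>

lemma superharmonic_if_infinite:
  fixes A :: "int ^ 'n ^ 'n"
  assumes gcm: "symmetric_gcm A" and ind: "indecomposable A" and inf: "infinite (weyl_group A)"
  obtains x :: "'n \<Rightarrow> real" where "\<And>i. 0 < x i"
    and "\<And>i. (\<Sum>j\<in>UNIV. real_of_int (A $ i $ j) * x j) \<le> 0"
proof -
  define B :: "real ^ 'n ^ 'n" where "B = (\<chi> i j. real_of_int (A $ i $ j))"
  have form: "y \<bullet> (B *v z) = (\<Sum>i\<in>UNIV. \<Sum>j\<in>UNIV. real_of_int (A $ i $ j) * (y $ i * z $ j))" for y z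
    by (simp add: inner_vec_def matrix_vector_mult_def B_def sum_distrib_left mult_ac)
  have symm: "y \<bullet> (B *v z) = z \<bullet> (B *v y)" for y z
    unfolding form by (subst sum.swap) (simp add: entry_sym [OF gcm] mult_ac)
  obtain l w where w: "w \<bullet> w = 1" "w \<bullet> (B *v w) = l"
    and le: "\<And>y. l * (y \<bullet> y) \<le> y \<bullet> (B *v y)"
    by (rule quadratic_form_minimum [of B]) blast
  have "l \<le> 0"
  proof (rule ccontr)
    assume "\<not> l \<le> 0"
    moreover have "l * (\<Sum>i\<in>UNIV. (real_of_int (z $ i))\<^sup>2) \<le> real_of_int (cartan_norm A z)" for z
      using le [of "\<chi> i. real_of_int (z $ i)"] unfolding form
      by (simp add: inner_vec_def cartan_norm_def matrix_vector_mult_def power2_eq_square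
          sum_distrib_left mult_ac)
    ultimately show False
      using finite_weyl_group_if_positive_definite [OF gcm, of l] inf by simp
  qed
  define x where "x = (\<chi> i. \<bar>w $ i\<bar>)"
  have xx: "x \<bullet> x = 1"
    using w(1) by (simp add: x_def inner_vec_def)
  have "x \<bullet> (B *v x) \<le> w \<bullet> (B *v w)"
    unfolding form
  proof (intro sum_mono)
    fix i j
    show "real_of_int (A $ i $ j) * (x $ i * x $ j) \<le> real_of_int (A $ i $ j) * (w $ i * w $ j)"
    proof (cases "i = j")
      case False
      have "w $ i * w $ j \<le> x $ i * x $ j"
        by (simp add: x_def flip: abs_mult)
      then show ?thesis
        using off_diag [OF gcm False] by (simp add: mult_left_mono_neg)
    qed (simp add: x_def)
  qed
  then have eig: "B *v x = l *\<^sub>R x"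
    using le [of x] w xx by (intro minimizer_is_eigenvector symm le) simp
  have super: "(\<Sum>j\<in>UNIV. real_of_int (A $ i $ j) * x $ j) = l * x $ i" for i
    using eig by (simp add: vec_eq_iff matrix_vector_mult_def B_def)
  have x_nonneg: "0 \<le> x $ i" for i
    by (simp add: x_def)
  define Z where "Z = {i. x $ i = 0}"
  have "Z = {}"
  proof (rule ccontr)
    assume "Z \<noteq> {}"
    moreover have "Z \<noteq> UNIV"
    proof
      assume "Z = UNIV"
      then have "x = 0" by (auto simp: Z_def vec_eq_iff)
      then show False using xx by simp
    qed
    ultimately obtain i j where ij: "i \<in> Z" "j \<notin> Z" "A $ i $ j \<noteq> 0"
      using indecomposable_connected [OF gcm ind] by blast
    \<comment> \<open>The diagonal term vanishes because \<open>i\<close> lies in \<open>Z\<close>.\<close>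
    have "0 \<le> - (real_of_int (A $ i $ k) * x $ k)" for k
      using ij(1) off_diag [OF gcm, of i k] x_nonneg [of k]
      by (cases "i = k") (auto simp: Z_def mult_nonpos_nonneg)
    moreover have "(\<Sum>k\<in>UNIV. - (real_of_int (A $ i $ k) * x $ k)) = 0"
      using super [of i] ij(1) by (simp add: Z_def sum_negf)
    ultimately have "real_of_int (A $ i $ j) * x $ j = 0"
      by (simp add: sum_nonneg_eq_0_iff)
    then show False
      using ij by (simp add: Z_def)
  qed
  then have "0 < x $ i" for i
    using x_nonneg [of i] by (auto simp: Z_def less_le)
  moreover have "(\<Sum>j\<in>UNIV. real_of_int (A $ i $ j) * x $ j) \<le> 0" for i
    using super [of i] \<open>l \<le> 0\<close> x_nonneg [of i] by (simp add: mult_nonpos_nonneg)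
  ultimately show ?thesis
    using that [of "\<lambda>i. x $ i"] by simp
qed

section \<open>Powers of Coxeter elements\<close>

lemma coxeter_element_power:
  assumes gcm: "symmetric_gcm A"
  shows "coxeter_element A vs [^]\<^bsub>GL_lattice\<^esub> (k :: nat) =
    reflection_product A (concat (replicate k (rev vs)))"
proof (induction k)
  case 0
  show ?case by (simp add: word_Nil [OF gcm] one_GL_lattice)
next
  case (Suc k)
  have "concat (replicate (Suc k) (rev vs)) = concat (replicate k (rev vs)) @ rev vs"
    using arg_cong [OF replicate_append_same [of k "rev vs"], of concat]
    by (simp only: replicate_Suc concat_append concat.simps append_Nil2)
  then show ?case
    using Suc by (simp add: coxeter_element_def word_append [OF gcm] mult_GL_lattice
        word_in_GL [OF gcm])
qed

lemma inverse_word: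
  assumes gcm: "symmetric_gcm A"
  shows "inv\<^bsub>GL_lattice\<^esub> (reflection_product A js) = reflection_product A (rev js)"
proof (rule group.inv_equality [OF group_GL_lattice])
  have "reflection_product A (rev js) \<circ> reflection_product A js = id"
    by (rule ext) (simp add: word_rev_cancel [OF gcm])
  then show "reflection_product A (rev js) \<otimes>\<^bsub>GL_lattice\<^esub> reflection_product A js =
      \<one>\<^bsub>GL_lattice\<^esub>"
    by (simp add: mult_GL_lattice word_in_GL [OF gcm] one_GL_lattice)
qed (rule word_in_GL [OF gcm])+

theorem theorem4p8:
  fixes A :: "int ^ 'n ^ 'n" and vs :: "'n list"
  assumes "symmetric_gcm A" and "indecomposable A"
    and "distinct vs" and "set vs = UNIV"
  shows "infinite (weyl_group A) \<longleftrightarrow>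
    (\<forall>m :: int. int (weyl_length A (coxeter_element A vs [^]\<^bsub>GL_lattice\<^esub> m)) = \<bar>m\<bar> * int CARD('n))"
proof
  assume "infinite (weyl_group A)"
  from superharmonic_if_infinite [OF assms(1,2) this]
  obtain x :: "'n \<Rightarrow> real" where x: "\<And>i. 0 < x i"
    "\<And>i. (\<Sum>j\<in>UNIV. real_of_int (A $ i $ j) * x j) \<le> 0"
    by blast
  have us: "distinct (rev vs)" "set (rev vs) = UNIV"
    using assms(3,4) by simp_all
  have n: "length (rev vs) = CARD('n)"
    using distinct_card [OF assms(3)] assms(4) by simp
  have pos: "weyl_length A (coxeter_element A vs [^]\<^bsub>GL_lattice\<^esub> k) = k * CARD('n)" for k :: nat
    using coxeter_powers_reduced [OF assms(1) us x, of k]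
    by (simp only: coxeter_element_power [OF assms(1)] n)
  have neg: "weyl_length A (inv\<^bsub>GL_lattice\<^esub> (coxeter_element A vs [^]\<^bsub>GL_lattice\<^esub> k)) =
      k * CARD('n)" for k :: nat
    using pos [of k]
    by (simp only: coxeter_element_power [OF assms(1)] inverse_word [OF assms(1)]
        length_rev [OF assms(1)])
  show "\<forall>m :: int. int (weyl_length A (coxeter_element A vs [^]\<^bsub>GL_lattice\<^esub> m)) =
      \<bar>m\<bar> * int CARD('n)"
  proof
    fix m :: int
    show "int (weyl_length A (coxeter_element A vs [^]\<^bsub>GL_lattice\<^esub> m)) = \<bar>m\<bar> * int CARD('n)"
    proof (cases "m < 0")
      case True
      then have eq: "coxeter_element A vs [^]\<^bsub>GL_lattice\<^esub> m =
          inv\<^bsub>GL_lattice\<^esub> (coxeter_element A vs [^]\<^bsub>GL_lattice\<^esub> nat (- m))"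
        by (simp only: int_pow_def2 if_True)
      then show ?thesis
        unfolding eq neg using True by simp
    next
      case False
      then have eq: "coxeter_element A vs [^]\<^bsub>GL_lattice\<^esub> m =
          coxeter_element A vs [^]\<^bsub>GL_lattice\<^esub> nat m"
        by (simp only: int_pow_def2 if_False)
      then show ?thesis
        unfolding eq pos using False by simp
    qed
  qed
next
  assume *: "\<forall>m :: int. int (weyl_length A (coxeter_element A vs [^]\<^bsub>GL_lattice\<^esub> m)) =
      \<bar>m\<bar> * int CARD('n)"
  define w where "w k = reflection_product A (concat (replicate k (rev vs)))" for k
  have len: "weyl_length A (w k) = k * CARD('n)" for k
  proof -
    have eq: "coxeter_element A vs [^]\<^bsub>GL_lattice\<^esub> int k = w k"
      by (simp only: int_pow_int coxeter_element_power [OF assms(1)] w_def)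
    show ?thesis
      using spec [OF *, of "int k"] unfolding eq
      by (simp only: abs_of_nat of_nat_mult [symmetric] of_nat_eq_iff)
  qed
  have "inj w"
  proof (rule injI)
    fix k k' assume "w k = w k'"
    then have "k * CARD('n) = k' * CARD('n)"
      using len [of k] len [of k'] by (simp only:)
    then show "k = k'" by simp
  qed
  then have "infinite (range w)"
    by (rule range_inj_infinite)
  moreover have "range w \<subseteq> weyl_group A"
    unfolding weyl_group_eq_products [OF assms(1)] w_def by blast
  ultimately show "infinite (weyl_group A)"
    using finite_subset by blast
qed

end
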